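(* For every $n\ge1$, the number of alternation acyclic tournaments on the set $\{1,\ldots,n\}$ is the median Genocchi number $H_{2n-1}$.
   Context: A tournament on $\{1,\ldots,n\}$ has, for each pair $i\ne j$, exactly one of the arcs $i\to j$, $j\to i$; an arc $i\to j$ is an ascent if $i<j$, a descent if $i>j$; a tournament is alternation acyclic if it has no directed cycle along which ascents and descents alternate. The median Genocchi numbers $H_1,H_3,H_5,H_7,H_9,\ldots=1,2,8,56,608,\ldots$ (OEIS A005439) may be given by $H_{2n-1}=\sum_{k=1}^n(-1)^{n-k}(k!)^2 PS_n^{(k)}$, where the Legendre–Stirling numbers satisfy $PS_0^{(0)}=1$, $PS_n^{(0)}=PS_0^{(k)}=0$ for $n,k\ge1$, and $PS_n^{(k)}=PS_{n-1}^{(k-1)}+k(k+1)PS_{n-1}^{(k)}$. *)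

theory Defs
  imports "Graph_Theory.Pair_Digraph" "Graph_Theory.Arc_Walk"
begin

text \<open>
  Digraphs without parallel arcs are the library's pair digraphs, an arc \<open>i \<rightarrow> j\<close> being the pair
  \<open>(i, j)\<close>. The locale predicate below says that arcs join vertices and that there are no loops.
\<close>

definition tournament_on :: "'a set \<Rightarrow> 'a pair_pre_digraph \<Rightarrow> bool" where
  "tournament_on V T \<longleftrightarrow>
     pair_loopfree_digraph T \<and> pverts T = V \<and>
     (\<forall>i\<in>V. \<forall>j\<in>V. i \<noteq> j \<longrightarrow> ((i, j) \<in> parcs T) \<noteq> ((j, i) \<in> parcs T))"

definition ascent :: "'a::linorder \<times> 'a \<Rightarrow> bool" where
  "ascent a \<longleftrightarrow> fst a < snd a"

definition descent :: "'a::linorder \<times> 'a \<Rightarrow> bool" where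
  "descent a \<longleftrightarrow> fst a > snd a"

text \<open>
  A cycle is given by its list of arcs. Alternation is understood cyclically, so the last arc is
  also compared with the first one; in particular, an alternating cycle has even length.
\<close>

definition alternating :: "('a::linorder \<times> 'a) list \<Rightarrow> bool" where
  "alternating p \<longleftrightarrow>
     (\<forall>i < length p.
        let a = p ! i; b = p ! (Suc i mod length p)
        in (ascent a \<and> descent b) \<or> (descent a \<and> ascent b))"

text \<open>
  The library predicate \<open>pre_digraph.cycle\<close> requires a nonempty closed walk following the
  direction of the arcs, without repeated vertices apart from the common start and end.
\<close>

definition alternation_acyclic :: "'a::linorder pair_pre_digraph \<Rightarrow> bool" where
  "alternation_acyclic T \<longleftrightarrow> \<not> (\<exists>p. pre_digraph.cycle (with_proj T) p \<and> alternating p)"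

text \<open>\<open>legendre_stirling n k\<close> is $PS_n^{(k)}$.\<close>

fun legendre_stirling :: "nat \<Rightarrow> nat \<Rightarrow> nat" where
  "legendre_stirling 0 0 = 1"
| "legendre_stirling (Suc n) 0 = 0"
| "legendre_stirling 0 (Suc k) = 0"
| "legendre_stirling (Suc n) (Suc k) =
     legendre_stirling n k + Suc k * (Suc k + 1) * legendre_stirling n (Suc k)"

text \<open>
  Median Genocchi numbers are traditionally indexed by odd numbers; \<open>median_genocchi n\<close>
  is $H_{2n-1}$, for \<open>n \<ge> 1\<close>. The sum is taken over the integers because its terms alternate in sign.
\<close>

definition median_genocchi :: "nat \<Rightarrow> int" where
  "median_genocchi n =
     (\<Sum>k = 1..n. (- 1) ^ (n - k) * (fact k) ^ 2 * int (legendre_stirling n k))"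

lemma median_genocchi_values: "map median_genocchi [1, 2, 3, 4, 5] = [1, 2, 8, 56, 608]"
  by code_simp

end

theory Submission
  imports Defs
begin

text \<open>
  Split every vertex \<open>i\<close> into a valley, which is left by ascents and entered by descents, and a peak,
  which is entered by ascents and left by descents. Tournaments on \<open>{1..n}\<close> become orientations of
  the bipartite graph joining the valley of \<open>i\<close> to the peak of \<open>j\<close> for \<open>i < j\<close>, and alternating cycles
  become directed cycles; conversely a directed cycle yields one of length 4, whose vertices come from
  four distinct \<open>i\<close>. By Stanley's theorem, the number of acyclic orientations is the value of the
  chromatic polynomial at \<open>-1\<close>, up to sign. Colouring peak 1, valley 1, peak 2, valley 2, \<open>\<dots>\<close> in this
  order and keeping track of the number \<open>k\<close> of colours of the valleys turns this value into the sum over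
  Legendre-Stirling numbers.
\<close>

section \<open>Acyclic orientations with prescribed sinks\<close>

definition acyclic_orientations :: "('a \<Rightarrow> 'a \<Rightarrow> bool) \<Rightarrow> 'a set \<Rightarrow> ('a \<times> 'a) set set" where
  "acyclic_orientations E U =
     {R. R \<subseteq> {(a, b). a \<in> U \<and> b \<in> U \<and> E a b} \<and>
         (\<forall>a\<in>U. \<forall>b\<in>U. E a b \<longrightarrow> ((a, b) \<in> R) \<noteq> ((b, a) \<in> R)) \<and> acyclic R}"

definition indep_set :: "('a \<Rightarrow> 'a \<Rightarrow> bool) \<Rightarrow> 'a set \<Rightarrow> bool" where
  "indep_set E S \<longleftrightarrow> (\<forall>a\<in>S. \<forall>b\<in>S. \<not> E a b)"

definition sinks :: "'a set \<Rightarrow> ('a \<times> 'a) set \<Rightarrow> 'a set" where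
  "sinks U R = {a\<in>U. \<forall>b. (a, b) \<notin> R}"

lemma finite_acyclic_orientations: "finite U \<Longrightarrow> finite (acyclic_orientations E U)"
  by (rule finite_subset[of _ "Pow (U \<times> U)"]) (auto simp: acyclic_orientations_def)

lemma acyclic_orientations_empty: "acyclic_orientations E {} = {{}}"
  by (auto simp: acyclic_orientations_def acyclic_def)

lemma sinks_nonempty:
  assumes "finite U" "U \<noteq> {}" "R \<in> acyclic_orientations E U"
  shows "sinks U R \<noteq> {}"
proof -
  have R: "R \<subseteq> U \<times> U" "acyclic R"
    using assms(3) by (auto simp: acyclic_orientations_def)
  then have "finite R"
    using assms(1) finite_subset by blast
  then have "wf (R\<inverse>)"
    using R(2) by (rule finite_acyclic_wf_converse)
  moreover obtain x where "x \<in> U"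
    using assms(2) by blast
  ultimately obtain z where "z \<in> U" "\<And>y. (y, z) \<in> R\<inverse> \<Longrightarrow> y \<notin> U"
    by (rule wfE_min) blast
  then have "z \<in> sinks U R"
    using R(1) by (auto simp: sinks_def)
  then show ?thesis
    by blast
qed

text \<open>No arc of \<open>R'\<close> leaves \<open>S\<close>, so a path that ends outside
  \<open>S\<close> never enters it and uses arcs of \<open>R\<close> only.\<close>

lemma trancl_add_sinks:
  assumes "(u, v) \<in> R'\<^sup>+" "v \<notin> S" "\<And>a b. (a, b) \<in> R' \<Longrightarrow> a \<notin> S \<and> (b \<in> S \<or> (a, b) \<in> R)"
  shows "(u, v) \<in> R\<^sup>+"
  using assms(1,2)
proof (induction rule: trancl_induct)
  case (base y)
  then show ?case using assms(3) by blast
next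
  case (step y z)
  then show ?case using assms(3) by (meson trancl.trancl_into_trancl)
qed

text \<open>If \<open>S\<close> consists of sinks, every edge between \<open>S\<close> and the rest
  points into \<open>S\<close>, and independence excludes edges inside \<open>S\<close>. So the
  restriction to \<open>U - S\<close> determines the orientation, and putting \<open>S\<close> back
  creates no cycle.\<close>

lemma card_orientations_with_sinks:
  assumes sym: "\<And>a b. E a b \<Longrightarrow> E b a" and "S \<subseteq> U" and ind: "indep_set E S"
  shows "card {R \<in> acyclic_orientations E U. S \<subseteq> sinks U R} = card (acyclic_orientations E (U - S))"
proof (rule bij_betw_same_card)
  let ?f = "\<lambda>R. R \<inter> (U - S) \<times> (U - S)"
  let ?g = "\<lambda>R. R \<union> {(a, b). a \<in> U - S \<and> b \<in> S \<and> E a b}"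
  have f: "?f R \<in> acyclic_orientations E (U - S)" if "R \<in> acyclic_orientations E U" for R
  proof -
    have "acyclic (?f R)"
      using that by (auto simp: acyclic_orientations_def intro: acyclic_subset)
    then show ?thesis
      using that by (auto simp: acyclic_orientations_def)
  qed
  have g: "?g R \<in> acyclic_orientations E U \<and> S \<subseteq> sinks U (?g R)"
    if R: "R \<in> acyclic_orientations E (U - S)" for R
  proof -
    have sub: "R \<subseteq> (U - S) \<times> (U - S)" and ac: "acyclic R"
      using R by (auto simp: acyclic_orientations_def)
    have "acyclic (?g R)"
      unfolding acyclic_def
    proof (intro allI notI)
      fix x assume x: "(x, x) \<in> (?g R)\<^sup>+"
      then obtain y where "(x, y) \<in> ?g R"
        by (meson tranclD)
      then have "x \<notin> S"
        using sub by auto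
      then have "(x, x) \<in> R\<^sup>+"
        by (rule trancl_add_sinks[OF x]) (use sub in auto)
      then show False
        using ac by (auto simp: acyclic_def)
    qed
    moreover have "((a, b) \<in> ?g R) \<noteq> ((b, a) \<in> ?g R)" if "a \<in> U" "b \<in> U" "E a b" for a b
      using that R sub sym ind unfolding acyclic_orientations_def indep_set_def by blast
    moreover have "?g R \<subseteq> {(a, b). a \<in> U \<and> b \<in> U \<and> E a b}"
      using R \<open>S \<subseteq> U\<close> by (auto simp: acyclic_orientations_def)
    moreover have "S \<subseteq> sinks U (?g R)"
      using sub \<open>S \<subseteq> U\<close> by (auto simp: sinks_def)
    ultimately show ?thesis
      unfolding acyclic_orientations_def by blast
  qed
  show "bij_betw ?f {R \<in> acyclic_orientations E U. S \<subseteq> sinks U R} (acyclic_orientations E (U - S))"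
  proof (rule bij_betw_byWitness[where f' = ?g])
    show "\<forall>R\<in>{R \<in> acyclic_orientations E U. S \<subseteq> sinks U R}. ?g (?f R) = R"
    proof
      fix R assume "R \<in> {R \<in> acyclic_orientations E U. S \<subseteq> sinks U R}"
      then have sub: "R \<subseteq> {(a, b). a \<in> U \<and> b \<in> U \<and> E a b}"
        and tot: "\<And>a b. a \<in> U \<Longrightarrow> b \<in> U \<Longrightarrow> E a b \<Longrightarrow> ((a, b) \<in> R) \<noteq> ((b, a) \<in> R)"
        and out: "\<And>a b. a \<in> S \<Longrightarrow> (a, b) \<notin> R"
        by (auto simp: acyclic_orientations_def sinks_def)
      show "?g (?f R) = R"
        using sub tot out \<open>S \<subseteq> U\<close> by blast
    qed
    show "\<forall>R\<in>acyclic_orientations E (U - S). ?f (?g R) = R"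
      by (auto simp: acyclic_orientations_def)
    show "?f ` {R \<in> acyclic_orientations E U. S \<subseteq> sinks U R} \<subseteq> acyclic_orientations E (U - S)"
      using f by blast
    show "?g ` acyclic_orientations E (U - S) \<subseteq> {R \<in> acyclic_orientations E U. S \<subseteq> sinks U R}"
      using g by blast
  qed
qed

lemma sum_alternating_subsets:
  assumes "finite A" "A \<noteq> {}"
  shows "(\<Sum>S\<in>Pow A. (- 1) ^ card S) = (0 :: int)"
  \<comment> \<open>The product of \<open>1 - 1\<close> over \<open>A\<close>, expanded.\<close>
  using prod_diff_conv_sum[of A "\<lambda>_. 1" "\<lambda>_. 1 :: int"] assms by (simp add: power_0_left)

text \<open>Inclusion-exclusion over sets of sinks; an acyclic orientation has at least one sink.\<close>

lemma sum_independent_acyclic_orientations: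
  assumes sym: "\<And>a b. E a b \<Longrightarrow> E b a" and fin: "finite U" and "U \<noteq> {}"
  shows "(\<Sum>S | S \<subseteq> U \<and> indep_set E S.
            (- 1) ^ card S * int (card (acyclic_orientations E (U - S)))) = 0"
proof -
  let ?A = "acyclic_orientations E U"
  have "(\<Sum>S | S \<subseteq> U \<and> indep_set E S. (- 1) ^ card S * int (card (acyclic_orientations E (U - S))))
      = (\<Sum>S | S \<subseteq> U \<and> indep_set E S. \<Sum>R | R \<in> ?A \<and> S \<subseteq> sinks U R. (- 1) ^ card S)"
    by (intro sum.cong) (auto simp: card_orientations_with_sinks[OF sym])
  also have "\<dots> = (\<Sum>R\<in>?A. \<Sum>S | S \<in> {S. S \<subseteq> U \<and> indep_set E S} \<and> S \<subseteq> sinks U R. (- 1) ^ card S)"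
    by (rule sum.swap_restrict) (use fin in \<open>auto simp: finite_acyclic_orientations\<close>)
  also have "\<dots> = (\<Sum>R\<in>?A. \<Sum>S\<in>Pow (sinks U R). (- 1) ^ card S)"
  proof (rule sum.cong[OF refl], rule sum.cong[OF _ refl])
    fix R assume R: "R \<in> ?A"
    \<comment> \<open>An edge between two sinks would have to leave one of them.\<close>
    have "indep_set E S" if "S \<subseteq> sinks U R" for S
      using that R unfolding indep_set_def sinks_def acyclic_orientations_def by blast
    then show "{S \<in> {S. S \<subseteq> U \<and> indep_set E S}. S \<subseteq> sinks U R} = Pow (sinks U R)"
      by (auto simp: sinks_def)
  qed
  also have "\<dots> = 0"
  proof (rule sum.neutral, rule ballI)
    fix R assume "R \<in> ?A"
    then show "(\<Sum>S\<in>Pow (sinks U R). (- 1) ^ card S) = (0 :: int)"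
      using sinks_nonempty[OF fin \<open>U \<noteq> {}\<close>] fin
      by (intro sum_alternating_subsets) (auto simp: sinks_def)
  qed
  finally show ?thesis .
qed

section \<open>Colourings of the valley-peak graph\<close>

text \<open>
  The valley of \<open>i\<close> is encoded as \<open>2 * i + 1\<close>, its peak as \<open>2 * i\<close>. Then the valley of \<open>i\<close> has a smaller
  code than the peak of \<open>j\<close> iff \<open>i < j\<close>, and the order of the codes is the order of colouring.
\<close>

definition adj :: "nat \<Rightarrow> nat \<Rightarrow> bool" where
  "adj a b \<longleftrightarrow> (odd a \<and> even b \<and> a < b) \<or> (even a \<and> odd b \<and> b < a)"

lemma adj_sym: "adj a b \<Longrightarrow> adj b a"
  by (auto simp: adj_def)

text \<open>
  The number of proper colourings of the vertices in a sorted list by \<open>q\<close> colours when \<open>k\<close> colours are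
  already taken by earlier odd vertices, as a polynomial in \<open>q\<close>.
\<close>

fun chrom :: "nat list \<Rightarrow> int \<Rightarrow> int \<Rightarrow> int" where
  "chrom [] k q = 1"
| "chrom (v # vs) k q =
     (if even v then (q - k) * chrom vs k q
      else k * chrom vs k q + (q - k) * chrom vs (k + 1) q)"

lemma sum_subsets_insert:
  assumes "finite A" "v \<notin> A"
  shows "(\<Sum>S | S \<subseteq> insert v A \<and> Q S. f S) =
    (\<Sum>S | S \<subseteq> A \<and> Q S. f S) + (\<Sum>S | S \<subseteq> A \<and> Q (insert v S). f (insert v S))"
proof -
  let ?B = "{S. S \<subseteq> A \<and> Q (insert v S)}"
  have "{S. S \<subseteq> insert v A \<and> Q S} = {S. S \<subseteq> A \<and> Q S} \<union> insert v ` ?B"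
  proof (intro set_eqI iffI)
    fix S assume S: "S \<in> {S. S \<subseteq> insert v A \<and> Q S}"
    show "S \<in> {S. S \<subseteq> A \<and> Q S} \<union> insert v ` ?B"
    proof (cases "v \<in> S")
      case True
      then have "S = insert v (S - {v})" by auto
      moreover have "S - {v} \<in> ?B" using S True by (auto simp: insert_absorb)
      ultimately show ?thesis by blast
    qed (use S in auto)
  qed auto
  moreover have "{S. S \<subseteq> A \<and> Q S} \<inter> insert v ` ?B = {}"
    using assms(2) by blast
  moreover have "inj_on (insert v) ?B"
    using assms(2) by (auto simp: inj_on_def insert_ident dest: subsetD)
  ultimately show ?thesis
    using assms(1) by (simp add: sum.union_disjoint sum.reindex)
qed

lemma filter_notin_insert:
  "v \<notin> set vs \<Longrightarrow> filter (\<lambda>u. u \<notin> insert v S) vs = filter (\<lambda>u. u \<notin> S) vs"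
  by (rule filter_cong) auto

text \<open>
  Here and in the next lemma \<open>S\<close> is the class of vertices that get one distinguished colour. In this
  lemma that colour is already taken by an earlier odd vertex, in the next one it is not.
\<close>

lemma sum_chrom_odd:
  assumes "sorted_wrt (<) vs"
  shows "(\<Sum>S | S \<subseteq> set vs \<and> (\<forall>v\<in>S. odd v). chrom (filter (\<lambda>v. v \<notin> S) vs) k (q - 1)) =
    chrom vs (k + 1) q"
  using assms
proof (induction vs arbitrary: k)
  case Nil
  have "{S. S = {} \<and> (\<forall>v\<in>S. odd v)} = {{} :: nat set}" by auto
  then show ?case by simp
next
  case (Cons v vs)
  have v: "v \<notin> set vs" using Cons.prems by auto
  have IH: "(\<Sum>S | S \<subseteq> set vs \<and> (\<forall>v\<in>S. odd v). chrom (filter (\<lambda>v. v \<notin> S) vs) k (q - 1)) =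
    chrom vs (k + 1) q" for k using Cons by auto
  have sub: "\<And>S. S \<subseteq> set vs \<and> Q S \<Longrightarrow> v \<notin> S" for Q using v by auto
  show ?case
  proof (cases "even v")
    case True
    then have eq: "(\<Sum>S | S \<subseteq> set (v # vs) \<and> (\<forall>v\<in>S. odd v). chrom (filter (\<lambda>v. v \<notin> S) (v # vs)) k (q - 1))
      = (\<Sum>S | S \<subseteq> set vs \<and> (\<forall>v\<in>S. odd v). (q - 1 - k) * chrom (filter (\<lambda>v. v \<notin> S) vs) k (q - 1))"
      using sub by (auto intro!: sum.cong simp: sum_subsets_insert v)
    then show ?thesis
      unfolding eq using True by (simp add: sum_distrib_left[symmetric] IH)
  next
    case False
    \<comment> \<open>In the first sum \<open>v\<close> gets one of the other \<open>q - 1\<close>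
      colours, reused or new; in the second it gets the distinguished one.\<close>
    then have eq: "(\<Sum>S | S \<subseteq> set (v # vs) \<and> (\<forall>v\<in>S. odd v). chrom (filter (\<lambda>v. v \<notin> S) (v # vs)) k (q - 1))
      = (\<Sum>S | S \<subseteq> set vs \<and> (\<forall>v\<in>S. odd v). k * chrom (filter (\<lambda>v. v \<notin> S) vs) k (q - 1)
            + (q - 1 - k) * chrom (filter (\<lambda>v. v \<notin> S) vs) (k + 1) (q - 1))
      + (\<Sum>S | S \<subseteq> set vs \<and> (\<forall>v\<in>S. odd v). chrom (filter (\<lambda>v. v \<notin> S) vs) k (q - 1))"
      unfolding list.set sum_subsets_insert[OF finite_set v]
      using sub by (intro arg_cong2[where f = "(+)"] sum.cong) (auto simp: filter_notin_insert[OF v, simplified])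
    then show ?thesis
      unfolding eq using False by (simp add: sum.distrib sum_distrib_left[symmetric] IH) (simp add: algebra_simps)
  qed
qed

lemma sum_chrom_independent:
  assumes "sorted_wrt (<) vs"
  shows "(\<Sum>S | S \<subseteq> set vs \<and> indep_set adj S. chrom (filter (\<lambda>v. v \<notin> S) vs) k (q - 1)) =
    chrom vs k q"
  using assms
proof (induction vs arbitrary: k)
  case Nil
  have "{S. S = {} \<and> indep_set adj S} = {{} :: nat set}" by (auto simp: indep_set_def)
  then show ?case by simp
next
  case (Cons v vs)
  have v: "v \<notin> set vs" and less: "\<And>u. u \<in> set vs \<Longrightarrow> v < u" using Cons.prems by auto
  have IH: "(\<Sum>S | S \<subseteq> set vs \<and> indep_set adj S. chrom (filter (\<lambda>v. v \<notin> S) vs) k (q - 1)) =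
    chrom vs k q" for k using Cons by auto
  have sub: "\<And>S. S \<subseteq> set vs \<and> Q S \<Longrightarrow> v \<notin> S" for Q using v by auto
  show ?case
  proof (cases "even v")
    case True
    \<comment> \<open>An even smallest vertex has no neighbour among the later ones, so adding
      \<open>v\<close> to \<open>S\<close> does not affect independence.\<close>
    have ind: "S \<subseteq> set vs \<and> indep_set adj (insert v S) \<longleftrightarrow> S \<subseteq> set vs \<and> indep_set adj S" for S
      using True less by (fastforce simp: indep_set_def adj_def)
    from True have eq: "(\<Sum>S | S \<subseteq> set (v # vs) \<and> indep_set adj S. chrom (filter (\<lambda>v. v \<notin> S) (v # vs)) k (q - 1))
      = (\<Sum>S | S \<subseteq> set vs \<and> indep_set adj S. (q - 1 - k) * chrom (filter (\<lambda>v. v \<notin> S) vs) k (q - 1))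
      + (\<Sum>S | S \<subseteq> set vs \<and> indep_set adj S. chrom (filter (\<lambda>v. v \<notin> S) vs) k (q - 1))"
      unfolding list.set sum_subsets_insert[OF finite_set v] ind
      using sub by (intro arg_cong2[where f = "(+)"] sum.cong) (auto simp: filter_notin_insert[OF v, simplified])
    then show ?thesis
      unfolding eq using True by (simp add: sum_distrib_left[symmetric] IH) (simp add: algebra_simps)
  next
    case False
    \<comment> \<open>An odd smallest vertex is adjacent to every later even one. Once it has the
      distinguished colour, only odd vertices can share it, which is the situation of
      \<open>sum_chrom_odd\<close>.\<close>
    have ind: "S \<subseteq> set vs \<and> indep_set adj (insert v S) \<longleftrightarrow> S \<subseteq> set vs \<and> (\<forall>v\<in>S. odd v)" for S
      using False less by (fastforce simp: indep_set_def adj_def)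
    from False have eq: "(\<Sum>S | S \<subseteq> set (v # vs) \<and> indep_set adj S. chrom (filter (\<lambda>v. v \<notin> S) (v # vs)) k (q - 1))
      = (\<Sum>S | S \<subseteq> set vs \<and> indep_set adj S. k * chrom (filter (\<lambda>v. v \<notin> S) vs) k (q - 1)
            + (q - 1 - k) * chrom (filter (\<lambda>v. v \<notin> S) vs) (k + 1) (q - 1))
      + (\<Sum>S | S \<subseteq> set vs \<and> (\<forall>v\<in>S. odd v). chrom (filter (\<lambda>v. v \<notin> S) vs) k (q - 1))"
      unfolding list.set sum_subsets_insert[OF finite_set v] ind
      using sub by (intro arg_cong2[where f = "(+)"] sum.cong) (auto simp: filter_notin_insert[OF v, simplified])
    then show ?thesis
      unfolding eq using False Cons.prems
      by (simp add: sum.distrib sum_distrib_left[symmetric] IH sum_chrom_odd) (simp add: algebra_simps)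
  qed
qed

text \<open>
  Stanley's theorem for this graph: both sides satisfy the same recursion, on the right because
  \<open>chrom vs 0 0 = 0\<close> for nonempty \<open>vs\<close>.
\<close>

lemma card_acyclic_orientations:
  assumes "sorted_wrt (<) vs"
  shows "int (card (acyclic_orientations adj (set vs))) = (- 1) ^ length vs * chrom vs 0 (- 1)"
  using assms
proof (induction "length vs" arbitrary: vs rule: less_induct)
  case less
  show ?case
  proof (cases "vs = []")
    case True
    then show ?thesis by (simp add: acyclic_orientations_empty)
  next
    case False
    let ?I = "{S. S \<subseteq> set vs \<and> indep_set adj S}"
    let ?rest = "\<lambda>S. filter (\<lambda>v. v \<notin> S) vs"
    let ?a = "\<lambda>S. (- 1) ^ card S * int (card (acyclic_orientations adj (set vs - S)))"
    let ?c = "\<lambda>S. (- 1) ^ length vs * chrom (?rest S) 0 (- 1)"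
    have dist: "distinct vs"
      using less.prems by (simp add: strict_sorted_iff)
    \<comment> \<open>The choice \<open>q = 0\<close> turns the \<open>q - 1\<close> colours left
      for the other vertices into \<open>-1\<close>.\<close>
    have "(\<Sum>S\<in>?I. ?c S) = (- 1) ^ length vs * chrom vs 0 0"
      using sum_chrom_independent[OF less.prems, of 0 0] by (simp add: sum_distrib_left[symmetric])
    moreover have "chrom vs 0 0 = 0"
      using False by (cases vs) auto
    moreover have "(\<Sum>S\<in>?I. ?a S) = 0"
      using False by (intro sum_independent_acyclic_orientations) (auto intro: adj_sym)
    ultimately have eq: "(\<Sum>S\<in>?I. ?a S) = (\<Sum>S\<in>?I. ?c S)"
      by simp
    have emp: "{} \<in> ?I" and fin: "finite ?I"
      by (auto simp: indep_set_def)
    have "?a S = ?c S" if S: "S \<in> ?I - {{}}" for S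
    proof -
      have set: "set (?rest S) = set vs - S" by auto
      then have len: "length vs = length (?rest S) + card S"
        using S dist
        by (metis (no_types, lifting) Diff_iff card_Diff_subset card_mono
            distinct_card distinct_filter finite_set finite_subset le_add_diff_inverse2 mem_Collect_eq)
      moreover have "card S > 0"
        using S by (auto simp: card_gt_0_iff intro: finite_subset)
      ultimately have "int (card (acyclic_orientations adj (set (?rest S)))) =
          (- 1) ^ length (?rest S) * chrom (?rest S) 0 (- 1)"
        using less.prems by (intro less.hyps) (auto intro: sorted_wrt_filter)
      then show ?thesis
        unfolding set by (simp add: len power_add)
    qed
    \<comment> \<open>The sums agree, and so do the terms of all nonempty \<open>S\<close>; the
      remaining term, for the empty set, is the claim.\<close>
    then have "?a {} = ?c {}"
      using eq by (simp add: sum.remove[OF fin emp])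
    then show ?thesis by simp
  qed
qed

section \<open>Evaluation at -1 by Legendre-Stirling numbers\<close>

text \<open>The codes \<open>2 * j + 2\<close> and \<open>2 * j + 3\<close> are the peak and the
  valley of \<open>Suc j\<close>. At \<open>q = -1\<close> each factor \<open>q - k\<close> becomes
  \<open>-(k + 1)\<close>.\<close>

lemma chrom_two_steps:
  assumes "j < n"
  shows "chrom [2 * j + 2..<2 * n + 2] k (- 1) =
    - (k * (k + 1)) * chrom [2 * Suc j + 2..<2 * n + 2] k (- 1)
    + (k + 1)\<^sup>2 * chrom [2 * Suc j + 2..<2 * n + 2] (k + 1) (- 1)"
proof -
  have "[2 * j + 2..<2 * n + 2] = (2 * j + 2) # (2 * j + 3) # [2 * Suc j + 2..<2 * n + 2]"
    using assms by (simp add: upt_conv_Cons numeral_3_eq_3)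
  then show ?thesis
    by (simp add: power2_eq_square algebra_simps)
qed

text \<open>The exponent \<open>n + k\<close> has the parity of \<open>n - k\<close> for
  \<open>k \<le> n\<close> and avoids truncated subtraction.\<close>

definition signed_legendre :: "nat \<Rightarrow> nat \<Rightarrow> int" where
  "signed_legendre n k = (- 1) ^ (n + k) * (fact k)\<^sup>2 * int (legendre_stirling n k)"

lemma signed_legendre_Suc:
  "signed_legendre (Suc n) (Suc k) =
     (int k + 1)\<^sup>2 * signed_legendre n k - (int k + 1) * (int k + 2) * signed_legendre n (Suc k)"
  by (simp add: signed_legendre_def power2_eq_square algebra_simps)

lemma legendre_stirling_eq_0: "n < k \<Longrightarrow> legendre_stirling n k = 0"
  by (induction n k rule: legendre_stirling.induct) auto

text \<open>The coefficient \<open>signed_legendre j k\<close> is the weight with which the first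
  \<open>j\<close> peaks and valleys lead to \<open>k\<close> valley colours: the factors in
  \<open>chrom_two_steps\<close> are those of the recursion
  \<open>signed_legendre_Suc\<close>.\<close>

lemma chrom_upt_eq_sum:
  assumes "j \<le> n"
  shows "chrom [2..<2 * n + 2] 0 (- 1) =
    (\<Sum>k\<le>j. signed_legendre j k * chrom [2 * j + 2..<2 * n + 2] (int k) (- 1))"
  using assms
proof (induction j)
  case 0
  show ?case by (simp add: signed_legendre_def flip: numeral_2_eq_2)
next
  case (Suc j)
  let ?c = "\<lambda>k. chrom [2 * Suc j + 2..<2 * n + 2] (int k) (- 1)"
  let ?s = "signed_legendre j"
  have "chrom [2..<2 * n + 2] 0 (- 1) =
      (\<Sum>k\<le>j. ?s k * chrom [2 * j + 2..<2 * n + 2] (int k) (- 1))"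
    using Suc by simp
  also have "\<dots> = (\<Sum>k\<le>j. (int k + 1)\<^sup>2 * ?s k * ?c (Suc k)) - (\<Sum>k\<le>j. int k * (int k + 1) * ?s k * ?c k)"
    using Suc.prems unfolding sum_subtractf[symmetric]
    by (intro sum.cong refl, subst chrom_two_steps) (auto simp: algebra_simps)
  \<comment> \<open>The new term \<open>k = Suc j\<close> vanishes because
    \<open>legendre_stirling j (Suc j) = 0\<close>.\<close>
  also have "(\<Sum>k\<le>j. int k * (int k + 1) * ?s k * ?c k) = (\<Sum>k\<le>Suc j. int k * (int k + 1) * ?s k * ?c k)"
    by (simp add: signed_legendre_def legendre_stirling_eq_0)
  \<comment> \<open>The factor \<open>int k\<close> removes the term \<open>k = 0\<close>, so the
    index can be shifted.\<close>
  also have "\<dots> = (\<Sum>k\<le>j. (int k + 1) * (int k + 2) * ?s (Suc k) * ?c (Suc k))"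
    unfolding sum.atMost_Suc_shift by (simp add: algebra_simps)
  also have "(\<Sum>k\<le>j. (int k + 1)\<^sup>2 * ?s k * ?c (Suc k)) - \<dots> = (\<Sum>k\<le>j. signed_legendre (Suc j) (Suc k) * ?c (Suc k))"
    unfolding sum_subtractf[symmetric] by (intro sum.cong) (auto simp: signed_legendre_Suc algebra_simps)
  also have "\<dots> = (\<Sum>k\<le>Suc j. signed_legendre (Suc j) k * ?c k)"
    unfolding sum.atMost_Suc_shift by (simp add: signed_legendre_def)
  finally show ?case .
qed

lemma chrom_upt_eq_median_genocchi:
  assumes "n \<ge> 1"
  shows "chrom [2..<2 * n + 2] 0 (- 1) = median_genocchi n"
proof -
  \<comment> \<open>For \<open>j = n\<close> no vertex is left to colour, and \<open>chrom\<close>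
    of the empty list is 1.\<close>
  have "chrom [2..<2 * n + 2] 0 (- 1) = (\<Sum>k\<le>n. signed_legendre n k)"
    using chrom_upt_eq_sum[of n n] by simp
  also have "\<dots> = (\<Sum>k = 1..n. signed_legendre n k)"
  proof (rule sum.mono_neutral_right)
    show "\<forall>k\<in>{..n} - {1..n}. signed_legendre n k = 0"
      using assms by (cases n) (auto simp: signed_legendre_def not_le)
  qed auto
  also have "\<dots> = median_genocchi n"
    unfolding median_genocchi_def
  proof (intro sum.cong refl)
    fix k assume "k \<in> {1..n}"
    then have "n + k = (n - k) + 2 * k" by simp
    then have "(- 1 :: int) ^ (n + k) = (- 1) ^ (n - k)"
      by (metis power_add power_minus1_even mult.right_neutral)
    then show "signed_legendre n k = (- 1) ^ (n - k) * (fact k)\<^sup>2 * int (legendre_stirling n k)"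
      by (simp add: signed_legendre_def)
  qed
  finally show ?thesis .
qed

section \<open>Reduction of directed cycles to 4-cycles\<close>

text \<open>
  The largest vertex, if even, is adjacent to all odd ones, so every odd vertex on a path from it is
  already one of its out-neighbours.
\<close>

lemma acyclic_if_no_4_cycle:
  assumes "finite U" and R: "R \<subseteq> {(a, b). a \<in> U \<and> b \<in> U \<and> adj a b}"
    and tot: "\<And>a b. a \<in> U \<Longrightarrow> b \<in> U \<Longrightarrow> adj a b \<Longrightarrow> ((a, b) \<in> R) \<noteq> ((b, a) \<in> R)"
    and no4: "\<And>a b c d. even b \<Longrightarrow> (b, a) \<in> R \<Longrightarrow> (a, d) \<in> R \<Longrightarrow> (d, c) \<in> R \<Longrightarrow> (c, b) \<notin> R"
  shows "acyclic R"
  using assms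
proof (induction U arbitrary: R rule: finite_linorder_max_induct)
  case empty
  then show ?case by (simp add: acyclic_def)
next
  case (insert m A)
  note R = insert.prems(1) and tot = insert.prems(2) and no4 = insert.prems(3)
  let ?R = "R \<inter> A \<times> A"
  have "acyclic ?R"
  proof (rule insert.IH)
    show "?R \<subseteq> {(a, b). a \<in> A \<and> b \<in> A \<and> adj a b}"
      using R by auto
    show "((a, b) \<in> ?R) \<noteq> ((b, a) \<in> ?R)" if "a \<in> A" "b \<in> A" "adj a b" for a b
      using tot[of a b] that by auto
    show "(c, b) \<notin> ?R" if "even b" "(b, a) \<in> ?R" "(a, d) \<in> ?R" "(d, c) \<in> ?R" for a b c d
      using no4[of b a d c] that by auto
  qed
  \<comment> \<open>A closed path thus stays inside \<open>A\<close>, against the acyclicity of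
    \<open>?R\<close>, or yields a closed path at \<open>m\<close>, which is excluded next.\<close>
  moreover have avoid: "(u, v) \<in> ?R\<^sup>+ \<or> ((u, m) \<in> R\<^sup>* \<and> (m, v) \<in> R\<^sup>*)" if "(u, v) \<in> R\<^sup>+" for u v
    using that
  proof (induction rule: trancl_induct)
    case (base y)
    then show ?case using R by (cases "u = m \<or> y = m") auto
  next
    case (step y z)
    show ?case
    proof (cases "y = m \<or> z = m")
      case True
      then show ?thesis using step by (auto intro: trancl_into_rtrancl)
    next
      case False
      then have "(y, z) \<in> ?R" using step R by auto
      then show ?thesis using step by (meson rtrancl.rtrancl_into_rtrancl trancl.trancl_into_trancl)
    qed
  qed
  moreover have "(m, m) \<notin> R\<^sup>+"
  proof (cases "even m")
    \<comment> \<open>An odd vertex is adjacent to larger ones only, so an odd maximum has no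
      arcs.\<close>
    case False
    then have "(m, v) \<notin> R" for v
      using R insert.hyps(2) by (fastforce simp: adj_def)
    then show ?thesis by (meson tranclD)
  next
    case True
    have "if odd v then (m, v) \<in> R else v = m \<or> (\<exists>x. (m, x) \<in> R \<and> (x, v) \<in> R)"
      if "(m, v) \<in> R\<^sup>*" for v
      using that
    proof (induction rule: rtrancl_induct)
      case base
      then show ?case using True by simp
    next
      case (step y z)
      have adj: "adj y z" and zU: "z \<in> insert m A" using step R by auto
      show ?case
      proof (cases "odd y")
        case True
        then show ?thesis using step adj by (auto simp: adj_def)
      next
        case False
        then have z: "odd z" using adj by (auto simp: adj_def)
        show ?thesis
        proof (cases "y = m")
          case True
          then show ?thesis using step z by simp
        next
          case False
          with \<open>\<not> odd y\<close> step obtain x where x: "(m, x) \<in> R" "(x, y) \<in> R"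
            by auto
          have "adj m z"
            using z zU True insert.hyps(2) by (auto simp: adj_def)
          \<comment> \<open>An arc from \<open>z\<close> to \<open>m\<close> would close the 4-cycle
            \<open>m\<close>, \<open>x\<close>, \<open>y\<close>, \<open>z\<close>.\<close>
          moreover have "(z, m) \<notin> R"
            using no4[OF True x step(2)] .
          ultimately have "(m, z) \<in> R"
            using tot[of m z] zU by auto
          then show ?thesis using z by simp
        qed
      qed
    qed
    then have inv: "(m, v) \<in> R" if "(m, v) \<in> R\<^sup>*" "odd v" for v
      using that by meson
    show ?thesis
    proof
      assume "(m, m) \<in> R\<^sup>+"
      then obtain v where v: "(m, v) \<in> R\<^sup>*" "(v, m) \<in> R"
        by (meson tranclD2)
      then have vU: "v \<in> insert m A" "adj v m" using R by auto
      then have "odd v" using True by (auto simp: adj_def)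
      then show False using inv[OF v(1)] v(2) tot[of v m] vU by auto
    qed
  qed
  ultimately show ?case
    unfolding acyclic_def by (meson rtrancl_trancl_trancl rtranclD trancl_rtrancl_trancl)
qed

section \<open>Tournaments as orientations of the valley-peak graph\<close>

text \<open>An ascent from \<open>i\<close> to \<open>j\<close> lifts to the arc from
  \<open>2 * i + 1\<close> to \<open>2 * j\<close> only, a descent to the arc from
  \<open>2 * i\<close> to \<open>2 * j + 1\<close> only.\<close>

definition split_arcs :: "(nat \<times> nat) set \<Rightarrow> (nat \<times> nat) set" where
  "split_arcs A = {(u, v). adj u v \<and> (u div 2, v div 2) \<in> A}"

lemma pcas_consecutive:
  assumes "pcas u p v" "p \<noteq> []"
  shows "fst (p ! 0) = u \<and> snd (last p) = v \<and> (\<forall>i. Suc i < length p \<longrightarrow> snd (p ! i) = fst (p ! Suc i))"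
  using assms
proof (induction u p v rule: pcas.induct)
  case (2 u e es v)
  then show ?case
    by (cases es) (auto simp: nth_Cons split: nat.splits)
qed simp

text \<open>On an alternating cycle the lift of each arc ends where the lift of the next one starts,
  since an ascent ends at a peak and a descent leaves from one, and likewise for valleys.\<close>

lemma alternation_acyclic_if_acyclic_split:
  assumes "acyclic (split_arcs (parcs T))"
  shows "alternation_acyclic T"
  unfolding alternation_acyclic_def
proof (intro notI, elim exE conjE)
  fix p assume "pre_digraph.cycle (with_proj T) p" and alt: "alternating p"
  then obtain u where p: "set p \<subseteq> parcs T" "pcas u p u" "p \<noteq> []"
    by (auto simp: pre_digraph.cycle_def pre_digraph.awalk_def cas_with_proj_eq)
  let ?l = "length p"
  have cyc: "snd (p ! i) = fst (p ! (Suc i mod ?l))" if "i < ?l" for i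
  proof (cases "Suc i = ?l")
    case True
    then have "p ! i = last p" using p(3) by (metis diff_Suc_1 last_conv_nth)
    then show ?thesis using True pcas_consecutive[OF p(2,3)] by simp
  next
    case False
    then show ?thesis using that pcas_consecutive[OF p(2,3)] by simp
  qed
  \<comment> \<open>The tail of the lift of the arc with index \<open>i\<close>; reducing
    \<open>i\<close> modulo the length makes \<open>c\<close> periodic, so the lifted path closes
    up.\<close>
  define c where "c i = (let a = p ! (i mod ?l) in if ascent a then 2 * fst a + 1 else 2 * fst a)" for i
  have step: "(c i, c (Suc i)) \<in> split_arcs (parcs T)" for i
  proof -
    let ?i = "i mod ?l"
    define a b where "a = p ! ?i" and "b = p ! (Suc ?i mod ?l)"
    have i: "?i < ?l" using p(3) by simp
    then have "a \<in> parcs T" using p(1) by (auto simp: a_def)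
    moreover have "snd a = fst b" using cyc[OF i] by (simp add: a_def b_def)
    moreover have "(ascent a \<and> descent b) \<or> (descent a \<and> ascent b)"
      using alt i by (simp add: alternating_def a_def b_def Let_def)
    moreover have "c i = (if ascent a then 2 * fst a + 1 else 2 * fst a)"
      "c (Suc i) = (if ascent b then 2 * fst b + 1 else 2 * fst b)"
      by (simp_all add: c_def Let_def a_def b_def mod_Suc_eq)
    ultimately show ?thesis
      by (cases a; cases b) (auto simp: split_arcs_def adj_def ascent_def descent_def)
  qed
  have "(c 0, c (Suc m)) \<in> (split_arcs (parcs T))\<^sup>+" for m
    by (induction m) (use step in \<open>auto intro: trancl.trancl_into_trancl\<close>)
  from this[of "?l - 1"] have "(c 0, c ?l) \<in> (split_arcs (parcs T))\<^sup>+"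
    using p(3) by simp
  moreover have "c ?l = c 0" by (simp add: c_def)
  ultimately show False using assms by (simp add: acyclic_def)
qed

lemma div2_in_iff: "u div 2 \<in> {1..n} \<longleftrightarrow> u \<in> {2..<2 * n + 2 :: nat}"
  by auto

lemma split_arcs_orientation:
  assumes "tournament_on {1..n} T"
  shows "split_arcs (parcs T) \<subseteq> {(a, b). a \<in> {2..<2 * n + 2} \<and> b \<in> {2..<2 * n + 2} \<and> adj a b}"
    and "a \<in> {2..<2 * n + 2} \<Longrightarrow> b \<in> {2..<2 * n + 2} \<Longrightarrow> adj a b \<Longrightarrow>
      ((a, b) \<in> split_arcs (parcs T)) \<noteq> ((b, a) \<in> split_arcs (parcs T))"
proof -
  have T: "pair_loopfree_digraph T" "pverts T = {1..n}"
    using assms by (simp_all add: tournament_on_def)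
  have tot: "((i, j) \<in> parcs T) \<noteq> ((j, i) \<in> parcs T)" if "i \<in> {1..n}" "j \<in> {1..n}" "i \<noteq> j" for i j
    using assms that unfolding tournament_on_def by blast
  interpret pair_loopfree_digraph T by fact
  show "split_arcs (parcs T) \<subseteq> {(a, b). a \<in> {2..<2 * n + 2} \<and> b \<in> {2..<2 * n + 2} \<and> adj a b}"
    unfolding split_arcs_def div2_in_iff[symmetric] T(2)[symmetric]
    by (auto dest: in_arcsD1 in_arcsD2)
  show "((a, b) \<in> split_arcs (parcs T)) \<noteq> ((b, a) \<in> split_arcs (parcs T))"
    if "a \<in> {2..<2 * n + 2}" "b \<in> {2..<2 * n + 2}" "adj a b"
  proof -
    have "a div 2 \<noteq> b div 2" using that(3) by (auto simp: adj_def elim!: oddE evenE)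
    then have "((a div 2, b div 2) \<in> parcs T) \<noteq> ((b div 2, a div 2) \<in> parcs T)"
      using tot that(1,2) unfolding div2_in_iff[symmetric] by blast
    then show ?thesis
      using that(3) adj_sym[OF that(3)] unfolding split_arcs_def by blast
  qed
qed

lemma all_less_four: "(\<forall>i<Suc (Suc (Suc (Suc 0))). P i) \<longleftrightarrow> P 0 \<and> P 1 \<and> P 2 \<and> P 3"
  by (auto simp: less_Suc_eq numeral_eq_Suc)

text \<open>A general cycle of the split graph may use both the valley and the peak of some
  \<open>i\<close>, and then its projection repeats a vertex. A 4-cycle cannot, since both its
  valleys are joined to both its peaks and hence belong to smaller numbers.\<close>

lemma acyclic_split_if_alternation_acyclic:
  assumes T: "tournament_on {1..n} T" and "alternation_acyclic T"
  shows "acyclic (split_arcs (parcs T))"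
proof (rule acyclic_if_no_4_cycle[OF _ split_arcs_orientation[OF T]])
  let ?R = "split_arcs (parcs T)"
  fix a b c d :: nat
  assume "even b" and R: "(b, a) \<in> ?R" "(a, d) \<in> ?R" "(d, c) \<in> ?R"
  show "(c, b) \<notin> ?R"
  proof
    assume cb: "(c, b) \<in> ?R"
    have adj: "adj b a" "adj a d" "adj d c" "adj c b"
      using R cb by (auto simp: split_arcs_def)
    then have par: "odd a" "even d" "odd c" using \<open>even b\<close> by (auto simp: adj_def)
    have asym: "(v, u) \<notin> ?R" if "(u, v) \<in> ?R" for u v
      using split_arcs_orientation[OF T] that by blast
    \<comment> \<open>Equality would make two consecutive arcs of the 4-cycle opposite to each
      other.\<close>
    have "a \<noteq> c" "b \<noteq> d" using asym R cb by auto
    moreover obtain a' b' c' d' where abcd: "a = 2 * a' + 1" "b = 2 * b'" "c = 2 * c' + 1" "d = 2 * d'"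
      using par \<open>even b\<close> by (elim oddE evenE) auto
    ultimately have ne: "a' \<noteq> c'" "b' \<noteq> d'" by auto
    have less: "a' < b'" "a' < d'" "c' < b'" "c' < d'"
      using adj by (auto simp: abcd adj_def)
    let ?p = "[(b', a'), (a', d'), (d', c'), (c', b')]"
    have arcs: "set ?p \<subseteq> parcs T"
      using R cb by (auto simp: abcd split_arcs_def)
    have "b' \<in> pverts T"
      using T arcs by (auto simp: tournament_on_def pair_loopfree_digraph_def dest: pair_wf_digraph.in_arcsD1)
    then have "pre_digraph.cycle (with_proj T) ?p"
      unfolding pre_digraph.cycle_def pre_digraph.awalk_def using arcs ne less
      by (intro exI[of _ b']) (auto simp: cas_with_proj_eq awalk_verts_with_proj_eq)
    moreover have "alternating ?p"
      using less by (simp add: alternating_def ascent_def descent_def all_less_four)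
    ultimately show False
      using assms(2) by (auto simp: alternation_acyclic_def)
  qed
qed simp

text \<open>The odd one of two adjacent codes is the one with the smaller half, so the halves
  determine the parities.\<close>

lemma adj_div2_inject:
  assumes "adj u v" "adj u' v'" "u div 2 = u' div 2" "v div 2 = v' div 2"
  shows "u = u'" "v = v'"
  using assms by (auto simp: adj_def elim!: oddE evenE)

lemma bij_betw_acyclic_orientations:
  "bij_betw (\<lambda>T. split_arcs (parcs T)) {T. tournament_on {1..n} T \<and> alternation_acyclic T}
     (acyclic_orientations adj {2..<2 * n + 2})"
proof (rule bij_betw_byWitness)
  let ?f = "\<lambda>T :: nat pair_pre_digraph. split_arcs (parcs T)"
  \<comment> \<open>The inverse identifies the valley and the peak of each vertex again.\<close>
  let ?g = "\<lambda>R. \<lparr>pverts = {1..n}, parcs = (\<lambda>(u, v). (u div 2, v div 2)) ` R\<rparr> :: nat pair_pre_digraph"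
  let ?T = "{T. tournament_on {1..n} T \<and> alternation_acyclic T}"
  let ?O = "acyclic_orientations adj {2..<2 * n + 2}"
  show "\<forall>T\<in>?T. ?g (?f T) = T"
  proof
    fix T assume "T \<in> ?T"
    then have T: "pair_loopfree_digraph T" "pverts T = {1..n}"
      by (auto simp: tournament_on_def)
    have "(i, j) \<in> (\<lambda>(u, v). (u div 2, v div 2)) ` ?f T" if ij: "(i, j) \<in> parcs T" for i j
    proof -
      have "i \<noteq> j" using pair_loopfree_digraph.pair_no_loops[OF T(1) ij] by simp
      then consider "i < j" | "j < i" by linarith
      then show ?thesis
      proof cases
        case 1
        then have "(2 * i + 1, 2 * j) \<in> ?f T" using ij by (auto simp: split_arcs_def adj_def)
        then show ?thesis by (rule rev_image_eqI) simp
      next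
        case 2
        then have "(2 * i, 2 * j + 1) \<in> ?f T" using ij by (auto simp: split_arcs_def adj_def)
        then show ?thesis by (rule rev_image_eqI) simp
      qed
    qed
    then have "(\<lambda>(u, v). (u div 2, v div 2)) ` ?f T = parcs T"
      by (auto simp: split_arcs_def)
    then show "?g (?f T) = T" using T(2) by simp
  qed
  have fg: "?f (?g R) = R" if "R \<in> ?O" for R
  proof -
    have "adj u v" if "(u, v) \<in> R" for u v
      using that \<open>R \<in> ?O\<close> by (auto simp: acyclic_orientations_def)
    then show ?thesis
      using adj_div2_inject by (fastforce simp: split_arcs_def)
  qed
  then show "\<forall>R\<in>?O. ?f (?g R) = R" by blast
  show "?f ` ?T \<subseteq> ?O"
  proof (intro image_subsetI)
    fix T assume "T \<in> ?T"
    then have T: "tournament_on {1..n} T" and "alternation_acyclic T" by auto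
    then have "acyclic (?f T)" by (rule acyclic_split_if_alternation_acyclic)
    then show "?f T \<in> ?O"
      unfolding acyclic_orientations_def using split_arcs_orientation[OF T] by blast
  qed
  show "?g ` ?O \<subseteq> ?T"
  proof (intro image_subsetI)
    fix R assume R: "R \<in> ?O"
    then have sub: "R \<subseteq> {(a, b). a \<in> {2..<2 * n + 2} \<and> b \<in> {2..<2 * n + 2} \<and> adj a b}"
      and tot: "\<And>a b. a \<in> {2..<2 * n + 2} \<Longrightarrow> b \<in> {2..<2 * n + 2} \<Longrightarrow> adj a b \<Longrightarrow> ((a, b) \<in> R) \<noteq> ((b, a) \<in> R)"
      and ac: "acyclic R"
      by (auto simp: acyclic_orientations_def)
    have "alternation_acyclic (?g R)"
      using ac fg[OF R] by (intro alternation_acyclic_if_acyclic_split) (simp del: pair_pre_digraph.simps)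
    moreover have "pair_loopfree_digraph (?g R)"
      by unfold_locales (use sub in \<open>auto simp: adj_def elim!: oddE evenE\<close>)
    moreover have "((i, j) \<in> parcs (?g R)) \<noteq> ((j, i) \<in> parcs (?g R))"
      if less: "i < j" and ij: "i \<in> {1..n}" "j \<in> {1..n}" for i j
    proof -
      have mem: "(u, v) \<in> R \<longleftrightarrow> (u div 2, v div 2) \<in> parcs (?g R)" if "adj u v" for u v
        using fg[OF R] that unfolding split_arcs_def by blast
      have adj: "adj (2 * i + 1) (2 * j)" using less by (simp add: adj_def)
      then have "((2 * i + 1, 2 * j) \<in> R) \<noteq> ((2 * j, 2 * i + 1) \<in> R)"
        using ij by (intro tot) auto
      then show ?thesis
        unfolding mem[OF adj] mem[OF adj_sym[OF adj]] by simp
    qed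
    ultimately show "?g R \<in> ?T"
      unfolding tournament_on_def mem_Collect_eq
      by (metis linorder_neqE pair_pre_digraph.select_convs(1))
  qed
qed

theorem theorem4p4:
  fixes n :: nat
  assumes "n \<ge> 1"
  shows "int (card {T. tournament_on {1..n} T \<and> alternation_acyclic T}) = median_genocchi n"
proof -
  have "card {T. tournament_on {1..n} T \<and> alternation_acyclic T} =
      card (acyclic_orientations adj (set [2..<2 * n + 2]))"
    unfolding set_upt by (rule bij_betw_same_card[OF bij_betw_acyclic_orientations])
  \<comment> \<open>The list has even length \<open>2 * n\<close>, so the sign in
    \<open>card_acyclic_orientations\<close> is 1.\<close>
  then show ?thesis
    using card_acyclic_orientations[of "[2..<2 * n + 2]"] chrom_upt_eq_median_genocchi[OF assms]
    by (simp add: sorted_wrt_upt del: set_upt upt_Suc)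
qed

end
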